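(* Let $p$ be a prime. Let $A(n) = \operatorname{ct}[P(x,y)^n Q(x,y)]$ where $P, Q \in \mathbb{Z}[x^{\pm 1}, y^{\pm 1}]$ with $$P(x,y) = \sum_{(i,j) \in \{-1,0,1\}^2} a_{i,j} x^i y^j, \quad Q(x,y) = \alpha + \beta x + \gamma y + \delta x y.$$ Then, for any $n \in \mathbb{Z}_{\geq 0}$ and $k \in \{0, 1, \ldots, p-1\}$, $$A(pn+k) \equiv B(n) A(k) + \begin{cases} 0, & \text{if } k < p-1, \\ \tilde{A}(n), & \text{if } k = p-1, \end{cases} \pmod{p}.$$ Here, $B(n) = \operatorname{ct}[P(x,y)^n]$ and $\tilde{A}(n) = \operatorname{ct}[P(x,y)^n \tilde{Q}(x,y)]$ with $$\tilde{Q}(x,y) = Q(\sigma_x x, \sigma_y y) - \alpha + \delta \hat{Q}(x,y),$$ where $\sigma_x, \sigma_y \in \{0, \pm 1\}$ are given by $$\sigma_x = \left(\frac{a_{1,0}^2 - 4 a_{1,-1} a_{1,1}}{p}\right), \quad \sigma_y = \left(\frac{a_{0,1}^2 - 4 a_{-1,1} a_{1,1}}{p}\right),$$ and $$\hat{Q}(x,y) = \frac{a_{1,0}}{2 a_{1,1}}(1 - \sigma_x) x + \frac{a_{0,1}}{2 a_{1,1}}(1 - \sigma_y) y + (1 - \sigma_x \sigma_y) x y$$ provided that $p$ is odd and $p \nmid a_{1,1}$. If $p = 2$ or $p \mid a_{1,1}$, then $$\hat{Q}(x,y) = -a_{1,-1} a_{1,0}^{p-2} x - a_{-1,1} a_{0,1}^{p-2}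 y + (a_{1,1} - \sigma_x \sigma_y) x y,$$ with the understanding that, if $p = 2$, then $a^{p-2} = 1$ for any integer $a$.
   Context: For a Laurent polynomial $f$, $\operatorname{ct}[f]$ denotes its constant term. For an integer $d$, $(d/p)$ denotes the Kronecker symbol; thus for odd primes $p$ it is the Legendre symbol, with $(d/p) \equiv d^{(p-1)/2} \pmod p$, while $(d/2) \equiv d \pmod 2$. When $p$ is odd and $p \nmid a_{1,1}$, the coefficients of $\hat{Q}$ are rational numbers with denominators coprime to $p$, and congruences modulo $p$ are understood for such rationals (i.e. in $\mathbb{Z}_{(p)}$, equivalently division by $2a_{1,1}$ is carried out in $\mathbb{Z}/p\mathbb{Z}$). *)

theory Defs
  imports
    "HOL-Number_Theory.Number_Theory"
    "HOL-Library.Poly_Mapping"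
    "HOL-Library.Product_Plus"
begin

text \<open>
  Laurent polynomials in two variables are the finitely supported coefficient functions on
  exponent pairs; the multiplication provided by \<^theory>\<open>HOL-Library.Poly_Mapping\<close> is convolution
  with respect to componentwise addition of exponents.
\<close>

type_synonym 'a laurent2 = "(int \<times> int) \<Rightarrow>\<^sub>0 'a"

definition lmonom :: "'a::zero \<Rightarrow> int \<Rightarrow> int \<Rightarrow> 'a laurent2" where
  "lmonom c i j = Poly_Mapping.single (i, j) c"

abbreviation lconst :: "'a::zero \<Rightarrow> 'a laurent2" where
  "lconst c \<equiv> lmonom c 0 0"

abbreviation lX :: "'a::zero_neq_one laurent2" where
  "lX \<equiv> lmonom 1 1 0"

abbreviation lY :: "'a::zero_neq_one laurent2" where
  "lY \<equiv> lmonom 1 0 1"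

definition ct :: "'a::zero laurent2 \<Rightarrow> 'a" where
  "ct f = Poly_Mapping.lookup f (0, 0)"

definition rat_laurent :: "int laurent2 \<Rightarrow> rat laurent2" where
  "rat_laurent f = Poly_Mapping.map rat_of_int f"

text \<open>Only the nine values of \<open>a\<close> on \<open>{-1, 0, 1} \<times> {-1, 0, 1}\<close> matter.\<close>

definition P_poly :: "(int \<Rightarrow> int \<Rightarrow> int) \<Rightarrow> int laurent2" where
  "P_poly a = (\<Sum>(i, j) \<in> {-1, 0, 1} \<times> {-1, 0, 1}. lmonom (a i j) i j)"

text \<open>The polynomial \<open>Q\<close> as a function of what is substituted for its two variables.\<close>

definition Q_eval :: "'a::comm_ring_1 \<Rightarrow> 'a \<Rightarrow> 'a \<Rightarrow> 'a \<Rightarrow> 'a laurent2 \<Rightarrow> 'a laurent2 \<Rightarrow> 'a laurent2" where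
  "Q_eval \<alpha> \<beta> \<gamma> \<delta> u v =
     lconst \<alpha> + lconst \<beta> * u + lconst \<gamma> * v + lconst \<delta> * u * v"

text \<open>Agrees with the Kronecker symbol \<open>(d/p)\<close> when \<open>p\<close> is prime; only such \<open>p\<close> are used.\<close>

definition kronecker_prime :: "int \<Rightarrow> nat \<Rightarrow> int" where
  "kronecker_prime d p =
     (if p = 2 then (if even d then 0 else if d mod 8 \<in> {1, 7} then 1 else -1)
      else Legendre d (int p))"

definition sigma_x :: "nat \<Rightarrow> (int \<Rightarrow> int \<Rightarrow> int) \<Rightarrow> int" where
  "sigma_x p a = kronecker_prime ((a 1 0)\<^sup>2 - 4 * a 1 (-1) * a 1 1) p"

definition sigma_y :: "nat \<Rightarrow> (int \<Rightarrow> int \<Rightarrow> int) \<Rightarrow> int" where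
  "sigma_y p a = kronecker_prime ((a 0 1)\<^sup>2 - 4 * a (-1) 1 * a 1 1) p"

text \<open>
  In the second case with \<open>p = 2\<close>, the powers have exponent \<open>0\<close> and hence equal \<open>1\<close>, also for
  base \<open>0\<close>.
\<close>

definition Q_hat :: "nat \<Rightarrow> (int \<Rightarrow> int \<Rightarrow> int) \<Rightarrow> rat laurent2" where
  "Q_hat p a =
     (let \<sigma>x = sigma_x p a; \<sigma>y = sigma_y p a in
      if odd p \<and> \<not> int p dvd a 1 1 then
        lconst (rat_of_int (a 1 0) / (2 * rat_of_int (a 1 1)) * (1 - rat_of_int \<sigma>x)) * lX
        + lconst (rat_of_int (a 0 1) / (2 * rat_of_int (a 1 1)) * (1 - rat_of_int \<sigma>y)) * lY
        + lconst (1 - rat_of_int \<sigma>x * rat_of_int \<sigma>y) * lX * lY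
      else
        lconst (rat_of_int (- a 1 (-1) * a 1 0 ^ (p - 2))) * lX
        + lconst (rat_of_int (- a (-1) 1 * a 0 1 ^ (p - 2))) * lY
        + lconst (rat_of_int (a 1 1 - \<sigma>x * \<sigma>y)) * lX * lY)"

definition Q_tilde :: "nat \<Rightarrow> (int \<Rightarrow> int \<Rightarrow> int) \<Rightarrow> int \<Rightarrow> int \<Rightarrow> int \<Rightarrow> int \<Rightarrow> rat laurent2" where
  "Q_tilde p a \<alpha> \<beta> \<gamma> \<delta> =
     Q_eval (rat_of_int \<alpha>) (rat_of_int \<beta>) (rat_of_int \<gamma>) (rat_of_int \<delta>)
       (lconst (rat_of_int (sigma_x p a)) * lX) (lconst (rat_of_int (sigma_y p a)) * lY)
     - lconst (rat_of_int \<alpha>) + lconst (rat_of_int \<delta>) * Q_hat p a"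

definition Z_loc :: "nat \<Rightarrow> rat set" where
  "Z_loc p = {rat_of_int u / rat_of_int v | u v. \<not> int p dvd v}"

definition cong_loc :: "nat \<Rightarrow> rat \<Rightarrow> rat \<Rightarrow> bool" where
  "cong_loc p r s \<longleftrightarrow> r \<in> Z_loc p \<and> s \<in> Z_loc p \<and> (\<exists>z \<in> Z_loc p. r - s = rat_of_nat p * z)"

end

theory Submission
  imports Defs "HOL-Computational_Algebra.Polynomial"
begin

text \<open>
  Modulo \<open>p\<close>, the polynomial \<open>P^p\<close> has the same coefficients as \<open>P(x^p, y^p)\<close>. Hence, writing
  \<open>F = P^k Q\<close>, the constant term of \<open>P^(p n + k) Q = (P^p)^n F\<close> only sees the coefficients of \<open>F\<close>
  at exponents divisible by \<open>p\<close>: if \<open>H\<close> collects these coefficients, with the exponents divided by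
  \<open>p\<close>, then \<open>A(p n + k)\<close> is congruent to the constant term of \<open>P^n H\<close>
  (\<open>cartier_cong_times_P_poly_power\<close>).

  Exponents of \<open>F\<close> lie between \<open>-k\<close> and \<open>k + 1\<close> in each variable, and \<open>k < p\<close>, so
  \<open>H = A(k) + X x + Y y + Z x y\<close> (\<open>cartier_cong_P_poly_power_Q\<close>). Here the constant term contributes
  \<open>B(n) A(k)\<close>, and \<open>X\<close>, \<open>Y\<close>, \<open>Z\<close> vanish unless \<open>k = p - 1\<close>. In that case they come from the
  right edge, the top edge and the top right corner of the Newton square of \<open>P^(p-1)\<close>. The right
  edge is the power \<open>f^(p-1)\<close> of a quadratic polynomial \<open>f = c + b z + d z^2\<close>, and \<open>X\<close> is
  \<open>\<beta> s + \<delta> t\<close> with \<open>s\<close> the coefficient of \<open>f^(p-1)\<close> of degree \<open>p - 1\<close> and \<open>t\<close> the one of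
  degree \<open>p - 2\<close>; the top edge is the same with \<open>x\<close> and \<open>y\<close> exchanged.

  The middle coefficient \<open>s\<close> is the Kronecker symbol \<open>\<sigma>\<close> of the discriminant
  (\<open>central_trinomial_cong_legendre\<close>): for \<open>p = 2 h + 1\<close>, the congruence
  \<open>C(2k, k) = (-4)^k C(h, k)\<close>, which says that \<open>h\<close> is \<open>-1/2\<close> modulo \<open>p\<close>, turns the explicit sum
  for \<open>s\<close> into the binomial expansion of \<open>(b^2 - 4 c d)^h\<close>, and Euler's criterion applies.
  The neighbour \<open>t\<close> is then determined by \<open>b s + 2 d t = b\<close> modulo \<open>p\<close>
  (\<open>quadratic_power_coeff_relation\<close>), which is the derivative of \<open>f^p\<close> divided by \<open>p\<close>; so
  \<open>t = b (1 - \<sigma>) / (2 d)\<close> if \<open>2 d\<close> is invertible. If \<open>d\<close> is divisible by \<open>p\<close>, then \<open>f\<close> is linear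
  modulo \<open>p\<close> and the binomial theorem gives \<open>t\<close>; for \<open>p = 2\<close> it is read off directly. Together
  with \<open>Z = \<delta> a(1,1)^(p-1)\<close>, which Fermat's little theorem evaluates, these are the coefficients of
  \<open>Q_tilde\<close> (\<open>Q_tilde_eq_monomials\<close>).
\<close>

section \<open>Congruences modulo a prime in commutative rings\<close>

text \<open>
  The ``freshman's dream'' in a ring of any characteristic, as divisibility by the ring element \<open>p\<close>.
  Having it for all rings covers integers, polynomials and Laurent polynomials at once.
\<close>

lemma prime_dvd_power_add_diff:
  fixes x y :: "'a::comm_ring_1"
  assumes "prime p"
  shows "of_nat p dvd (x + y) ^ p - (x ^ p + y ^ p)"
proof -
  have p0: "p > 0" using assms prime_gt_0_nat by blast
  have "(x + y) ^ p = (\<Sum>k\<le>p. of_nat (p choose k) * x ^ k * y ^ (p - k))"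
    by (rule binomial_ring)
  also have "{..p} = insert 0 (insert p {0<..<p})" using p0 by auto
  also have "(\<Sum>k\<in>insert 0 (insert p {0<..<p}). of_nat (p choose k) * x ^ k * y ^ (p - k)) =
      y ^ p + x ^ p + (\<Sum>k\<in>{0<..<p}. of_nat (p choose k) * x ^ k * y ^ (p - k))"
    using p0 by (subst sum.insert) auto
  finally have "(x + y) ^ p - (x ^ p + y ^ p) =
      (\<Sum>k\<in>{0<..<p}. of_nat (p choose k) * x ^ k * y ^ (p - k))"
    by simp
  also have "of_nat p dvd \<dots>"
  proof (intro dvd_sum dvd_mult2)
    fix k assume "k \<in> {0<..<p}"
    then have "p dvd (p choose k)" using assms by (intro dvd_choose_prime) auto
    then show "of_nat p dvd (of_nat (p choose k) :: 'a)" by (metis dvd_def of_nat_mult)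
  qed
  finally show ?thesis .
qed

lemma prime_dvd_power_sum_diff:
  fixes f :: "'b \<Rightarrow> 'a::comm_ring_1"
  assumes "prime p" "finite S"
  shows "of_nat p dvd (\<Sum>i\<in>S. f i) ^ p - (\<Sum>i\<in>S. f i ^ p)"
  using assms(2)
proof (induction S rule: finite_induct)
  case empty
  then show ?case using prime_gt_0_nat[OF assms(1)] by (simp add: power_0_left)
next
  case (insert i S)
  have "of_nat p dvd ((f i + sum f S) ^ p - (f i ^ p + sum f S ^ p))
      + (sum f S ^ p - (\<Sum>i\<in>S. f i ^ p))"
    by (intro dvd_add prime_dvd_power_add_diff assms insert.IH)
  then show ?case using insert.hyps by (simp add: algebra_simps)
qed

lemma fermat_little_int:
  assumes "prime p"
  shows "[(x::int) ^ p = x] (mod int p)"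
proof -
  have nat: "[int n ^ p = int n] (mod int p)" for n
  proof (induction n)
    case 0
    then show ?case using prime_gt_0_nat[OF assms] by (simp add: power_0_left)
  next
    case (Suc n)
    have "[(int n + 1) ^ p = int n ^ p + 1 ^ p] (mod int p)"
      using prime_dvd_power_add_diff[OF assms, of "int n" 1] by (simp add: cong_iff_dvd_diff)
    also have "[int n ^ p + 1 ^ p = int n + 1] (mod int p)"
      using Suc.IH by (simp add: cong_add_rcancel)
    finally show ?case by (simp add: algebra_simps)
  qed
  define r where "r = nat (x mod int p)"
  have r: "[x = int r] (mod int p)"
    using prime_gt_0_nat[OF assms] by (simp add: r_def cong_def)
  then show ?thesis
    using cong_pow[OF r, of p] nat[of r] by (meson cong_sym cong_trans)
qed

section \<open>The middle coefficients of powers of a quadratic polynomial\<close>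

text \<open>
  Neighbouring entries in row \<open>p - 1\<close> of Pascal's triangle add up to an entry of row \<open>p\<close>, which
  is a multiple of \<open>p\<close>; so the signs alternate.
\<close>

lemma choose_prime_minus_one:
  assumes "prime p" "j < p"
  shows "[int ((p - 1) choose j) = (-1) ^ j] (mod int p)"
  using assms(2)
proof (induction j)
  case 0
  then show ?case by simp
next
  case (Suc j)
  have "p dvd (p choose Suc j)"
    using Suc.prems by (intro dvd_choose_prime[OF _ _ _ assms(1)]) auto
  moreover have "p choose Suc j = ((p - 1) choose j) + ((p - 1) choose Suc j)"
    using Suc.prems by (cases p) auto
  ultimately have "int p dvd int ((p - 1) choose j) + int ((p - 1) choose Suc j)"
    by (metis int_dvd_int_iff of_nat_add)
  moreover have "int p dvd int ((p - 1) choose j) - (-1) ^ j"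
    using Suc by (simp add: cong_iff_dvd_diff)
  ultimately have "int p dvd (int ((p - 1) choose j) + int ((p - 1) choose Suc j)) - (int ((p - 1) choose j) - (-1) ^ j)"
    by (rule dvd_diff)
  then show ?case by (simp add: cong_iff_dvd_diff)
qed

text \<open>
  Over the rationals \<open>C(2k, k) = (-4)^k C(-1/2, k)\<close>, and \<open>h\<close> is \<open>-1/2\<close> modulo \<open>p\<close>. The induction
  compares the recurrences of both sides in \<open>k\<close>; the factor \<open>k + 1\<close> can be cancelled because it is
  smaller than \<open>p\<close>.
\<close>

lemma central_binomial_cong:
  assumes "prime p" "p = 2 * h + 1" "k \<le> h"
  shows "[int ((2 * k) choose k) = (-4) ^ k * int (h choose k)] (mod int p)"
  using assms(3)
proof (induction k)
  case 0
  then show ?case by simp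
next
  case (Suc k)
  define X where "X = int ((2 * k) choose k)"
  define Y where "Y = int (h choose k)"
  have X: "int (Suc k) * int ((2 * Suc k) choose Suc k) = 2 * (2 * int k + 1) * X"
  proof -
    have 1: "Suc k * ((2 * Suc k) choose Suc k) = (2 * Suc k) * ((2 * k + 1) choose k)"
      using Suc_times_binomial[of k "2 * k + 1"] by simp
    have 2: "Suc k * ((2 * k + 1) choose Suc k) = (2 * k + 1) * ((2 * k) choose k)"
      using Suc_times_binomial[of k "2 * k"] by simp
    have 3: "(2 * k + 1) choose Suc k = (2 * k + 1) choose k"
      using binomial_symmetric[of k "2 * k + 1"] by simp
    have "Suc k * ((2 * Suc k) choose Suc k) = 2 * (Suc k * ((2 * k + 1) choose Suc k))"
      unfolding 1 3 by simp
    also have "\<dots> = 2 * (2 * k + 1) * ((2 * k) choose k)" unfolding 2 by simp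
    finally show ?thesis unfolding X_def
      by (metis (mono_tags, lifting) of_nat_mult of_nat_add of_nat_numeral of_nat_1)
  qed
  have Y: "int (Suc k) * int (h choose Suc k) = (int h - int k) * Y"
  proof -
    have "Suc k * (h choose Suc k) = (h - k) * (h choose k)"
      using binomial_absorption[of k h] binomial_absorb_comp[of h k] Suc.prems by simp
    then show ?thesis using Suc.prems unfolding Y_def
      by (metis Suc_leD of_nat_diff of_nat_mult)
  qed
  have "int p dvd 2 * (2 * int k + 1) * (X - (-4) ^ k * Y) + (-4) ^ k * Y * 2 * int p"
    using Suc by (intro dvd_add dvd_mult) (auto simp: cong_iff_dvd_diff X_def Y_def)
  also have "\<dots> = int (Suc k) * int ((2 * Suc k) choose Suc k)
      - (-4) ^ Suc k * (int (Suc k) * int (h choose Suc k))"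
    unfolding X Y assms(2) by (simp add: algebra_simps)
  also have "\<dots> = int (Suc k) * (int ((2 * Suc k) choose Suc k) - (-4) ^ Suc k * int (h choose Suc k))"
    by (simp add: algebra_simps)
  finally have "int p dvd int (Suc k) * (int ((2 * Suc k) choose Suc k) - (-4) ^ Suc k * int (h choose Suc k))" .
  moreover have "\<not> int p dvd int (Suc k)"
    using Suc.prems assms(2) by (auto dest!: dvd_imp_le simp only: int_dvd_int_iff)
  ultimately have "int p dvd int ((2 * Suc k) choose Suc k) - (-4) ^ Suc k * int (h choose Suc k)"
    using assms(1) by (metis prime_dvd_mult_iff prime_nat_int_transfer)
  then show ?case by (simp add: cong_iff_dvd_diff)
qed

text \<open>
  The special case without linear term; the general central coefficient is obtained from
  it by expanding with respect to the linear term.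
\<close>

lemma coeff_even_quadratic_power:
  fixes c d :: "'a::comm_ring_1"
  shows "coeff ([:c, 0, d:] ^ j) j = (if even j then of_nat (j choose (j div 2)) * (c * d) ^ (j div 2) else 0)"
proof -
  have "[:c, 0, d:] = monom d 2 + monom c 0"
    by (simp add: monom_altdef numeral_2_eq_2)
  then have "[:c, 0, d:] ^ j = (\<Sum>i\<le>j. of_nat (j choose i) * monom d 2 ^ i * monom c 0 ^ (j - i))"
    by (simp add: binomial_ring)
  also have "\<dots> = (\<Sum>i\<le>j. monom (of_nat (j choose i) * d ^ i * c ^ (j - i)) (2 * i))"
    by (intro sum.cong) (simp_all add: monom_power mult_monom of_nat_monom)
  finally have "coeff ([:c, 0, d:] ^ j) j =
      (\<Sum>i\<le>j. if 2 * i = j then of_nat (j choose i) * d ^ i * c ^ (j - i) else 0)"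
    by (simp add: coeff_sum coeff_monom)
  also have "\<dots> = (\<Sum>i\<le>j. if i = j div 2 then (if even j then of_nat (j choose i) * d ^ i * c ^ (j - i) else 0) else 0)"
    by (intro sum.cong) auto
  also have "\<dots> = (if even j then of_nat (j choose (j div 2)) * d ^ (j div 2) * c ^ (j - j div 2) else 0)"
    by simp
  also have "\<dots> = (if even j then of_nat (j choose (j div 2)) * (c * d) ^ (j div 2) else 0)"
    by (auto elim!: evenE simp: power_mult_distrib algebra_simps)
  finally show ?thesis .
qed

lemma central_trinomial_coeff:
  fixes b c d :: "'a::comm_ring_1"
  shows "coeff ([:c, b, d:] ^ (2 * h)) (2 * h) =
    (\<Sum>k\<le>h. of_nat ((2 * h) choose (2 * k)) * of_nat ((2 * k) choose k) * (c * d) ^ k * b ^ (2 * h - 2 * k))"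
proof -
  have shift: "of_nat n * g * monom x k = monom (of_nat n * x) k * g" for n k and g :: "'a poly" and x
    by (metis (no_types, lifting) add_0 mult.assoc mult.commute mult_monom of_nat_monom)
  have "[:c, b, d:] = [:c, 0, d:] + monom b 1"
    by (simp add: monom_altdef)
  then have "[:c, b, d:] ^ (2 * h) =
      (\<Sum>j\<le>2*h. of_nat ((2 * h) choose j) * [:c, 0, d:] ^ j * monom b 1 ^ (2 * h - j))"
    by (simp add: binomial_ring)
  also have "\<dots> = (\<Sum>j\<le>2*h. monom (of_nat ((2 * h) choose j) * b ^ (2 * h - j)) (2 * h - j) * [:c, 0, d:] ^ j)"
    by (intro sum.cong refl) (simp add: monom_power shift)
  finally have "coeff ([:c, b, d:] ^ (2 * h)) (2 * h) =
      (\<Sum>j\<le>2*h. of_nat ((2 * h) choose j) * b ^ (2 * h - j) * coeff ([:c, 0, d:] ^ j) j)"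
    by (auto simp: coeff_sum coeff_monom_mult intro!: sum.cong)
  \<comment> \<open>The terms with odd \<open>j\<close> vanish.\<close>
  also have "\<dots> = (\<Sum>j\<in>(\<lambda>k. 2 * k) ` {..h}. of_nat ((2 * h) choose j) * b ^ (2 * h - j) * coeff ([:c, 0, d:] ^ j) j)"
    by (intro sum.mono_neutral_right) (auto simp: coeff_even_quadratic_power elim!: evenE)
  also have "\<dots> = (\<Sum>k\<le>h. of_nat ((2 * h) choose (2 * k)) * of_nat ((2 * k) choose k) * (c * d) ^ k * b ^ (2 * h - 2 * k))"
    by (subst sum.reindex) (auto simp: inj_on_def coeff_even_quadratic_power algebra_simps)
  finally show ?thesis .
qed

text \<open>
  In the explicit sum, \<open>C(p - 1, 2k)\<close> is \<open>1\<close> and \<open>C(2k, k)\<close> is \<open>(-4)^k C(h, k)\<close> modulo \<open>p\<close>, where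
  \<open>h = (p - 1) / 2\<close>. What remains is the binomial expansion of the discriminant to the power \<open>h\<close>,
  which is the Legendre symbol by Euler's criterion. For \<open>p = 2\<close> both sides have the parity of \<open>b\<close>.
\<close>

lemma central_trinomial_cong_legendre:
  fixes b c d :: int
  assumes "prime p"
  shows "[coeff ([:c, b, d:] ^ (p - 1)) (p - 1) = kronecker_prime (b\<^sup>2 - 4 * c * d) p] (mod int p)"
proof (cases "p = 2")
  case True
  then show ?thesis
    by (auto simp: kronecker_prime_def cong_iff_dvd_diff)
next
  case False
  then have p2: "p > 2" using prime_ge_2_nat[OF assms] by simp
  then obtain h where h: "p = 2 * h + 1"
    using prime_odd_nat[OF assms] by (metis oddE)
  have "[coeff ([:c, b, d:] ^ (2 * h)) (2 * h) =
      (\<Sum>k\<le>h. 1 * ((-4) ^ k * int (h choose k)) * (c * d) ^ k * b ^ (2 * h - 2 * k))] (mod int p)"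
    unfolding central_trinomial_coeff
  proof (intro cong_sum cong_mult cong_refl)
    fix k assume "k \<in> {..h}"
    then have k: "k \<le> h" by simp
    show "[int ((2 * h) choose (2 * k)) = 1] (mod int p)"
      using choose_prime_minus_one[OF assms, of "2 * k"] k by (simp add: h)
    show "[int ((2 * k) choose k) = (-4) ^ k * int (h choose k)] (mod int p)"
      by (rule central_binomial_cong[OF assms h k])
  qed
  also have "(\<Sum>k\<le>h. 1 * ((-4) ^ k * int (h choose k)) * (c * d) ^ k * b ^ (2 * h - 2 * k)) =
      (\<Sum>k\<le>h. int (h choose k) * (- 4 * c * d) ^ k * (b\<^sup>2) ^ (h - k))"
  proof (intro sum.cong refl)
    fix k
    have "b ^ (2 * h - 2 * k) = (b\<^sup>2) ^ (h - k)"
      by (metis diff_mult_distrib2 power_mult)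
    moreover have "(- 4 * c * d) ^ k = (-4) ^ k * (c * d) ^ k"
      by (simp only: power_mult_distrib mult.assoc)
    ultimately show "1 * ((-4) ^ k * int (h choose k)) * (c * d) ^ k * b ^ (2 * h - 2 * k) =
        int (h choose k) * (- 4 * c * d) ^ k * (b\<^sup>2) ^ (h - k)"
      by (simp only: mult_ac mult_1)
  qed
  also have "\<dots> = (b\<^sup>2 - 4 * c * d) ^ h"
    using binomial_ring[of "- 4 * c * d" "b\<^sup>2" h] by simp
  also have "[\<dots> = kronecker_prime (b\<^sup>2 - 4 * c * d) p] (mod int p)"
    using euler_criterion[OF assms p2, of "b\<^sup>2 - 4 * c * d"] False
    by (simp add: kronecker_prime_def h cong_sym)
  finally show ?thesis by (simp add: h)
qed

text \<open>
  Let \<open>f = c + b z + d z^2\<close>. Compare the coefficients of degree \<open>p - 1\<close> in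
  \<open>(f^p)' = p f^(p-1) f'\<close> over the integers, where the factor \<open>p\<close> may be cancelled on both sides.
  What is left of \<open>(f^p)'\<close> is the coefficient of degree \<open>p\<close> in \<open>f^p\<close>, which is
  \<open>b^p\<close> modulo \<open>p\<close> because \<open>f^p\<close> agrees with \<open>c^p + b^p z^p + d^p z^(2p)\<close>.
\<close>

lemma quadratic_power_coeff_relation:
  fixes b c d :: int
  assumes "prime p"
  shows "[b * coeff ([:c, b, d:] ^ (p - 1)) (p - 1) + 2 * d * coeff ([:c, b, d:] ^ (p - 1)) (p - 2) = b]
    (mod int p)"
proof -
  define f where "f = [:c, b, d:]"
  obtain m where m: "p = Suc (Suc m)"
    using prime_ge_2_nat[OF assms] by (metis add_2_eq_Suc le_Suc_ex)
  have "int p * coeff (f ^ p) p = coeff (pderiv (f ^ p)) (p - 1)"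
    by (simp add: coeff_pderiv m)
  also have "\<dots> = int p * coeff (f ^ (p - 1) * [:b, 2 * d:]) (p - 1)"
    by (simp add: pderiv_power f_def pderiv_pCons)
  finally have "coeff (f ^ p) p = coeff (f ^ (p - 1) * [:b, 2 * d:]) (p - 1)"
    by (simp add: m)
  also have "\<dots> = b * coeff (f ^ (p - 1)) (p - 1) + 2 * d * coeff (f ^ (p - 1)) (p - 2)"
    by (simp add: m mult_pCons_right del: power_Suc)
  finally have rel: "b * coeff (f ^ (p - 1)) (p - 1) + 2 * d * coeff (f ^ (p - 1)) (p - 2) = coeff (f ^ p) p"
    by simp
  have "f = (\<Sum>i\<in>{0,1,2}. monom (coeff f i) i)"
    by (simp add: f_def monom_altdef numeral_2_eq_2)
  then have "of_nat p dvd f ^ p - (\<Sum>i\<in>{0,1,2}. monom (coeff f i) i ^ p)"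
    using prime_dvd_power_sum_diff[OF assms, of "{0,1,2}" "\<lambda>i. monom (coeff f i) i"] by simp
  also have "(\<Sum>i\<in>{0,1,2}. monom (coeff f i) i ^ p) = (\<Sum>i\<in>{0,1,2}. monom (coeff f i ^ p) (i * p))"
    by (simp add: monom_power)
  finally have "int p dvd coeff (f ^ p - (\<Sum>i\<in>{0,1,2}. monom (coeff f i ^ p) (i * p))) p"
    by (elim dvdE) (simp add: of_nat_poly)
  then have "[coeff (f ^ p) p = b ^ p] (mod int p)"
    by (simp add: f_def m cong_iff_dvd_diff del: power_Suc)
  also have "[b ^ p = b] (mod int p)" by (rule fermat_little_int[OF assms])
  finally show ?thesis using rel by (simp add: f_def)
qed

text \<open>
  When the quadratic term vanishes modulo \<open>p\<close>, the coefficient is \<open>(p - 1) c b^(p-2)\<close> by the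
  binomial theorem. For \<open>p = 2\<close> the coefficient is \<open>c\<close>, which is
  congruent to \<open>-c\<close>.
\<close>

lemma coeff_prime_minus_two_degenerate:
  fixes b c d :: int
  assumes "prime p" "p = 2 \<or> int p dvd d"
  shows "[coeff ([:c, b, d:] ^ (p - 1)) (p - 2) = - c * b ^ (p - 2)] (mod int p)"
proof (cases "p = 2")
  case True
  then show ?thesis by (simp add: cong_iff_dvd_diff)
next
  case False
  then have "int p dvd d" using assms by simp
  obtain m where m: "p = Suc (Suc m)"
    using prime_ge_2_nat[OF assms(1)] by (metis add_2_eq_Suc le_Suc_ex)
  have "[:c, b, d:] - [:c, b:] = [:0, 0, d:]" by simp
  moreover have "[:c, b, d:] - [:c, b:] dvd [:c, b, d:] ^ (p - 1) - [:c, b:] ^ (p - 1)"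
    using power_diff_sumr2 by (metis dvd_triv_left)
  moreover have "[:int p:] dvd [:0, 0, d:]"
    using \<open>int p dvd d\<close> by (simp add: const_poly_dvd_iff coeff_pCons split: nat.splits)
  ultimately have "[:int p:] dvd [:c, b, d:] ^ (p - 1) - [:c, b:] ^ (p - 1)"
    by (metis dvd_trans)
  then have "[coeff ([:c, b, d:] ^ (p - 1)) (p - 2) = coeff ([:c, b:] ^ (p - 1)) (p - 2)] (mod int p)"
    unfolding const_poly_dvd_iff cong_iff_dvd_diff by (metis coeff_diff)
  also have "coeff ([:c, b:] ^ (p - 1)) (p - 2) = int (p - 1) * (c * b ^ (p - 2))"
    by (subst coeff_linear_poly_power) (simp_all add: m)
  also have "[\<dots> = - c * b ^ (p - 2)] (mod int p)"
  proof -
    have "int (p - 1) * (c * b ^ (p - 2)) - (- c * b ^ (p - 2)) = int p * (c * b ^ (p - 2))"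
      by (simp add: m algebra_simps)
    then show ?thesis by (simp add: cong_iff_dvd_diff)
  qed
  finally show ?thesis .
qed

section \<open>Congruences between \<open>p\<close>-integral rational numbers\<close>

lemma Z_loc_divide: "\<not> int p dvd v \<Longrightarrow> rat_of_int u / rat_of_int v \<in> Z_loc p"
  unfolding Z_loc_def by blast

lemma Z_loc_of_int:
  assumes "prime p"
  shows "rat_of_int x \<in> Z_loc p"
  using Z_loc_divide[of p 1 x] prime_gt_1_nat[OF assms] by simp

lemma Z_loc_add:
  assumes "prime p" "x \<in> Z_loc p" "y \<in> Z_loc p"
  shows "x + y \<in> Z_loc p"
proof -
  obtain a b c d where *: "x = of_int a / of_int b" "\<not> int p dvd b" "y = of_int c / of_int d" "\<not> int p dvd d"
    using assms by (auto simp: Z_loc_def)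
  then have "b \<noteq> 0" "d \<noteq> 0" by auto
  then have "x + y = of_int (a * d + c * b) / of_int (b * d)"
    by (simp add: * add_frac_eq)
  moreover have "\<not> int p dvd b * d" using * assms(1) by (simp add: prime_dvd_mult_iff)
  ultimately show ?thesis unfolding Z_loc_def by blast
qed

lemma Z_loc_mult:
  assumes "prime p" "x \<in> Z_loc p" "y \<in> Z_loc p"
  shows "x * y \<in> Z_loc p"
proof -
  obtain a b c d where *: "x = of_int a / of_int b" "\<not> int p dvd b" "y = of_int c / of_int d" "\<not> int p dvd d"
    using assms by (auto simp: Z_loc_def)
  then have "x * y = of_int (a * c) / of_int (b * d)" by simp
  moreover have "\<not> int p dvd b * d" using * assms(1) by (simp add: prime_dvd_mult_iff)
  ultimately show ?thesis unfolding Z_loc_def by blast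
qed

lemma cong_loc_add:
  assumes "prime p" "cong_loc p x x'" "cong_loc p y y'"
  shows "cong_loc p (x + y) (x' + y')"
proof -
  obtain z w where "z \<in> Z_loc p" "w \<in> Z_loc p" "x - x' = of_nat p * z" "y - y' = of_nat p * w"
    using assms by (auto simp: cong_loc_def)
  then have "x + y - (x' + y') = of_nat p * (z + w)" "z + w \<in> Z_loc p"
    using assms(1) by (auto simp: algebra_simps intro: Z_loc_add)
  then show ?thesis using assms by (auto simp: cong_loc_def intro: Z_loc_add)
qed

lemma cong_loc_mult_left:
  assumes "prime p" "c \<in> Z_loc p" "cong_loc p x x'"
  shows "cong_loc p (c * x) (c * x')"
proof -
  obtain z where "z \<in> Z_loc p" "x - x' = of_nat p * z"
    using assms by (auto simp: cong_loc_def)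
  then have "c * x - c * x' = of_nat p * (c * z)" "c * z \<in> Z_loc p"
    using assms by (auto simp: algebra_simps intro: Z_loc_mult)
  then show ?thesis using assms by (auto simp: cong_loc_def intro: Z_loc_mult)
qed

text \<open>
  How a linear congruence between integers determines a fraction as a \<open>p\<close>-integral number.
\<close>

lemma cong_loc_divide:
  assumes "prime p" "\<not> int p dvd v" "[v * x = u] (mod int p)"
  shows "cong_loc p (of_int x) (of_int u / of_int v)"
proof -
  obtain k where k: "v * x - u = int p * k"
    using assms(3) by (auto simp: cong_iff_dvd_diff)
  have "v \<noteq> 0" using assms(2) by auto
  then have "of_int x - of_int u / of_int v = (of_int (v * x - u) / of_int v :: rat)"
    by (simp add: field_simps)
  also have "\<dots> = of_nat p * (of_int k / of_int v)" by (simp add: k)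
  finally show ?thesis
    unfolding cong_loc_def
    by (intro conjI Z_loc_of_int[OF assms(1)] Z_loc_divide[OF assms(2)]
        bexI[OF _ Z_loc_divide[OF assms(2), of k]])
qed

lemma cong_loc_of_int:
  assumes "prime p" "[x = y] (mod int p)"
  shows "cong_loc p (of_int x) (of_int y)"
  using cong_loc_divide[OF assms(1), of 1 x y] assms(2) prime_gt_1_nat[OF assms(1)] by simp

lemma cong_loc_trans_int:
  assumes "prime p" "[x = y] (mod int p)" "cong_loc p (of_int y) r"
  shows "cong_loc p (of_int x) r"
  using cong_loc_add[OF assms(1) cong_loc_of_int[OF assms(1), of "x - y" 0] assms(3)] assms(2)
  by (simp add: cong_iff_dvd_diff)

text \<open>
  For invertible \<open>2 d\<close>, the middle coefficient \<open>s\<close> is eliminated from \<open>b s + 2 d t = b\<close> by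
  \<open>s = \<sigma>\<close>. The case distinction is the one in \<open>Q_hat\<close>.
\<close>

lemma coeff_prime_minus_two_cong_loc:
  fixes b c d :: int
  assumes "prime p"
  defines "\<sigma> \<equiv> kronecker_prime (b\<^sup>2 - 4 * c * d) p"
  shows "cong_loc p (of_int (coeff ([:c, b, d:] ^ (p - 1)) (p - 2)))
    (if odd p \<and> \<not> int p dvd d then of_int b / (2 * of_int d) * (1 - of_int \<sigma>)
     else of_int (- c * b ^ (p - 2)))"
proof (cases "odd p \<and> \<not> int p dvd d")
  case True
  define s t where "s = coeff ([:c, b, d:] ^ (p - 1)) (p - 1)" and "t = coeff ([:c, b, d:] ^ (p - 1)) (p - 2)"
  have "int p dvd b * s + 2 * d * t - b" and "int p dvd s - \<sigma>"
    using quadratic_power_coeff_relation[OF assms(1), of b c d]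
      central_trinomial_cong_legendre[OF assms(1), of c b d]
    unfolding s_def t_def \<sigma>_def cong_iff_dvd_diff by -
  then have "int p dvd (b * s + 2 * d * t - b) - b * (s - \<sigma>)"
    by (rule dvd_diff[OF _ dvd_mult])
  then have "[2 * d * t = b * (1 - \<sigma>)] (mod int p)"
    by (simp add: cong_iff_dvd_diff algebra_simps)
  moreover have "\<not> int p dvd 2 * d"
  proof -
    have "\<not> int p dvd 2"
    proof
      assume "int p dvd 2"
      then have "p \<le> 2" using zdvd_imp_le[of "int p" 2] by simp
      then show False using True prime_ge_2_nat[OF assms(1)] by simp
    qed
    then show ?thesis using True assms(1) by (simp add: prime_dvd_mult_iff)
  qed
  ultimately have "cong_loc p (of_int t) (of_int (b * (1 - \<sigma>)) / of_int (2 * d))"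
    by (intro cong_loc_divide assms)
  then show ?thesis using True by (simp add: t_def)
next
  case False
  then have "p = 2 \<or> int p dvd d"
    using primes_dvd_imp_eq[OF two_is_prime_nat assms(1)] by auto
  then show ?thesis
    using cong_loc_of_int[OF assms(1) coeff_prime_minus_two_degenerate[OF assms(1)], of d c b] False
    by (simp only: if_False)
qed

section \<open>Coefficients of products with a sparse Laurent polynomial\<close>

abbreviation lcoeff :: "'a::zero laurent2 \<Rightarrow> int \<times> int \<Rightarrow> 'a" where
  "lcoeff \<equiv> Poly_Mapping.lookup"

lemma lookup_lmonom: "lcoeff (lmonom c i j) e = (if e = (i, j) then c else 0)"
  by (auto simp: lmonom_def lookup_single)

lemma lookup_lmonom_times:
  fixes c :: "'a::comm_ring_1"
  shows "lcoeff (lmonom c i j * f) (u, v) = c * lcoeff f (u - i, v - j)"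
proof -
  have eq: "(u, v) = (i, j) + q \<longleftrightarrow> q = (u - i, v - j)" for q by (cases q) auto
  then have "lcoeff (lmonom c i j * f) (u, v) =
      (\<Sum>l. (c when (i, j) = l) * (\<Sum>q. lcoeff f q when (u, v) = l + q))"
    by (simp add: lookup_mult lmonom_def lookup_single)
  also have "\<dots> = (\<Sum>l. c * (\<Sum>q. lcoeff f q when (u, v) = l + q) when l = (i, j))"
    by (intro Sum_any.cong) (auto simp: when_def)
  also have "\<dots> = c * lcoeff f (u - i, v - j)"
    by (simp add: eq)
  finally show ?thesis .
qed

lemma lookup_Q_eval_times:
  fixes \<alpha> :: "'a::comm_ring_1"
  shows "lcoeff (f * Q_eval \<alpha> \<beta> \<gamma> \<delta> lX lY) (u, v) =
    \<alpha> * lcoeff f (u, v) + \<beta> * lcoeff f (u - 1, v) + \<gamma> * lcoeff f (u, v - 1) + \<delta> * lcoeff f (u - 1, v - 1)"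
proof -
  have "f * Q_eval \<alpha> \<beta> \<gamma> \<delta> lX lY =
      lmonom \<alpha> 0 0 * f + lmonom \<beta> 1 0 * f + lmonom \<gamma> 0 1 * f + lmonom \<delta> 1 1 * f"
    by (simp add: Q_eval_def lmonom_def mult_single algebra_simps)
  then show ?thesis by (simp add: lookup_add lookup_lmonom_times)
qed

lemma lookup_P_poly_times:
  "lcoeff (P_poly a * f) (u, v) =
    (\<Sum>(i, j)\<in>{-1, 0, 1} \<times> {-1, 0, 1}. a i j * lcoeff f (u - i, v - j))"
  by (simp only: P_poly_def sum_distrib_right lookup_sum lookup_lmonom_times split_def)

lemma lookup_rat_laurent: "lcoeff (rat_laurent f) e = rat_of_int (lcoeff f e)"
  by (simp add: rat_laurent_def Poly_Mapping.map.rep_eq when_def)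

lemma rat_laurent_P_poly:
  "rat_laurent (P_poly a) = (\<Sum>(i, j)\<in>{-1, 0, 1} \<times> {-1, 0, 1}. lmonom (rat_of_int (a i j)) i j)"
  by (rule poly_mapping_eqI)
    (simp add: lookup_rat_laurent P_poly_def lookup_sum lookup_lmonom split_def of_int_sum if_distrib
      del: sum.insert cong: if_cong)

lemma rat_laurent_P_poly_times:
  "rat_laurent (P_poly a) * rat_laurent f = rat_laurent (P_poly a * f)"
proof (rule poly_mapping_eqI)
  fix e :: "int \<times> int"
  show "lcoeff (rat_laurent (P_poly a) * rat_laurent f) e = lcoeff (rat_laurent (P_poly a * f)) e"
    by (cases e) (simp only: rat_laurent_P_poly sum_distrib_right lookup_sum lookup_lmonom_times
        lookup_rat_laurent lookup_P_poly_times split_def of_int_sum of_int_mult)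
qed

lemma rat_laurent_P_poly_power: "rat_laurent (P_poly a) ^ n = rat_laurent (P_poly a ^ n)"
proof (induction n)
  case 0
  have "rat_laurent 1 = 1"
    by (rule poly_mapping_eqI) (simp add: lookup_rat_laurent lookup_one when_def)
  then show ?case by simp
next
  case (Suc n)
  then show ?case by (simp add: rat_laurent_P_poly_times)
qed

section \<open>The shape of the powers of \<open>P\<close>\<close>

text \<open>
  Exchanging the variables, so that statements about the \<open>y\<close> exponent follow from those about the
  \<open>x\<close> exponent.
\<close>

lemma lookup_P_poly_power_swap:
  "lcoeff (P_poly a ^ m) (u, v) = lcoeff (P_poly (\<lambda>i j. a j i) ^ m) (v, u)"
proof (induction m arbitrary: u v)
  case 0
  then show ?case by (auto simp: lookup_one when_def zero_prod_def)
next
  case (Suc m)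
  show ?case
    by (simp add: lookup_P_poly_times Suc.IH sum.cartesian_product[symmetric])
qed

lemma lookup_P_poly_power_eq_0_x:
  assumes "\<bar>u\<bar> > int m"
  shows "lcoeff (P_poly a ^ m) (u, v) = 0"
  using assms
proof (induction m arbitrary: u v)
  case 0
  then show ?case by (auto simp: lookup_one when_def zero_prod_def)
next
  case (Suc m)
  have "lcoeff (P_poly a ^ m) (u + 1, w) = 0" "lcoeff (P_poly a ^ m) (u, w) = 0"
    "lcoeff (P_poly a ^ m) (u - 1, w) = 0" for w
    using Suc.prems by (auto intro!: Suc.IH)
  then show ?case
    by (simp add: lookup_P_poly_times)
qed

lemma lookup_P_poly_power_eq_0:
  assumes "\<bar>u\<bar> > int m \<or> \<bar>v\<bar> > int m"
  shows "lcoeff (P_poly a ^ m) (u, v) = 0"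
  using assms lookup_P_poly_power_eq_0_x lookup_P_poly_power_swap[of a m u v] by metis

text \<open>
  Exponent \<open>m\<close> of \<open>x\<close> is only reached by taking the part \<open>a(1,-1)/y + a(1,0) + a(1,1) y\<close> beside
  \<open>x\<close> in each of the \<open>m\<close> factors. The shift by \<open>m\<close> in the second exponent clears the denominators
  \<open>y\<close>, so that an ordinary polynomial appears on the right.
\<close>

lemma lookup_P_poly_power_right_edge:
  "lcoeff (P_poly a ^ m) (int m, int v - int m) = coeff ([:a 1 (-1), a 1 0, a 1 1:] ^ m) v"
proof (induction m arbitrary: v)
  case 0
  then show ?case by (cases v) (auto simp: lookup_one when_def zero_prod_def)
next
  case (Suc m)
  define f where "f = [:a 1 (-1), a 1 0, a 1 1:]"
  define L where "L = lcoeff (P_poly a ^ m)"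
  have z: "L (u, w) = 0" if "u > int m \<or> w < - int m" for u w
    using that unfolding L_def by (intro lookup_P_poly_power_eq_0) auto
  have IH: "L (int m, int v - int m) = coeff (f ^ m) v" for v
    using Suc.IH by (simp add: L_def f_def)
  have c0: "coeff (f ^ Suc m) 0 = a 1 (-1) * coeff (f ^ m) 0"
    by (simp add: f_def)
  have c1: "coeff (f ^ Suc m) 1 = a 1 (-1) * coeff (f ^ m) 1 + a 1 0 * coeff (f ^ m) 0"
    by (simp add: f_def)
  have c2: "coeff (f ^ Suc m) (Suc (Suc k)) = a 1 (-1) * coeff (f ^ m) (Suc (Suc k))
      + a 1 0 * coeff (f ^ m) (Suc k) + a 1 1 * coeff (f ^ m) k" for k
    by (simp add: f_def)
  have "lcoeff (P_poly a ^ Suc m) (int (Suc m), int v - int (Suc m)) =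
      a 1 (-1) * L (int m, int v - int m) + a 1 0 * L (int m, int v - int m - 1)
      + a 1 1 * L (int m, int v - int m - 2)"
    unfolding power_Suc lookup_P_poly_times L_def[symmetric]
    by (simp add: sum.cartesian_product[symmetric] z algebra_simps)
  also have "\<dots> = coeff (f ^ Suc m) v"
  proof -
    consider "v = 0" | "v = 1" | k where "v = Suc (Suc k)" by (metis One_nat_def not0_implies_Suc)
    then show ?thesis
    proof cases
      case 1
      then show ?thesis using IH[of 0] z c0 by simp
    next
      case 2
      then show ?thesis using IH[of 0] IH[of 1] z c1 by simp
    next
      case 3
      then show ?thesis using IH[of k] IH[of "Suc k"] IH[of "Suc (Suc k)"] c2[of k]
        by (simp add: algebra_simps)
    qed
  qed
  finally show ?case by (simp only: f_def)
qed

section \<open>The Cartier operator modulo \<open>p\<close>\<close>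

text \<open>
  \<open>H\<close> is, modulo \<open>p\<close>, the image of \<open>G\<close> under the Cartier operator, which keeps the exponents
  divisible by \<open>p\<close> and divides them by \<open>p\<close>. A relation suffices here, and avoids constructing the
  operator on finitely supported functions.
\<close>

definition cartier_cong :: "nat \<Rightarrow> int laurent2 \<Rightarrow> int laurent2 \<Rightarrow> bool" where
  "cartier_cong p G H \<longleftrightarrow>
    (\<forall>u v. [lcoeff G (int p * u, int p * v) = lcoeff H (u, v)] (mod int p))"

lemma lookup_P_poly_prime_power_times:
  assumes "prime p"
  shows "[lcoeff (P_poly a ^ p * G) (int p * u, int p * v) =
    (\<Sum>(i, j)\<in>{-1, 0, 1} \<times> {-1, 0, 1}. a i j * lcoeff G (int p * (u - i), int p * (v - j)))] (mod int p)"
proof -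
  define S :: "(int \<times> int) set" where "S = {-1, 0, 1} \<times> {-1, 0, 1}"
  have pow: "lmonom (c :: int) i j ^ n = lmonom (c ^ n) (int n * i) (int n * j)" for c i j n
  proof (induction n)
    case 0
    then show ?case by (simp add: lmonom_def zero_prod_def[symmetric])
  next
    case (Suc n)
    then show ?case by (simp add: lmonom_def mult_single algebra_simps)
  qed
  have "of_nat p dvd P_poly a ^ p - (\<Sum>(i, j)\<in>S. lmonom (a i j) i j ^ p)"
    using prime_dvd_power_sum_diff[OF assms, of S "\<lambda>(i, j). lmonom (a i j) i j"]
    by (simp add: P_poly_def S_def split_def)
  then have "of_nat p dvd (P_poly a ^ p - (\<Sum>(i, j)\<in>S. lmonom (a i j) i j ^ p)) * G"
    by (rule dvd_mult2)
  then obtain R where "(P_poly a ^ p - (\<Sum>(i, j)\<in>S. lmonom (a i j) i j ^ p)) * G = of_nat p * R"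
    by (elim dvdE)
  moreover have "of_nat p = lconst (int p)"
    by (simp add: lmonom_def zero_prod_def[symmetric] single_of_nat)
  ultimately have "P_poly a ^ p * G = (\<Sum>(i, j)\<in>S. lmonom (a i j ^ p) (int p * i) (int p * j) * G)
      + lconst (int p) * R"
    by (simp add: left_diff_distrib sum_distrib_right pow split_def diff_eq_eq add.commute)
  then have "lcoeff (P_poly a ^ p * G) (int p * u, int p * v) =
      (\<Sum>(i, j)\<in>S. a i j ^ p * lcoeff G (int p * (u - i), int p * (v - j)))
      + int p * lcoeff R (int p * u, int p * v)"
    by (simp add: lookup_add lookup_sum lookup_lmonom_times split_def right_diff_distrib)
  also have "[\<dots> = (\<Sum>(i, j)\<in>S. a i j ^ p * lcoeff G (int p * (u - i), int p * (v - j)))] (mod int p)"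
    by (simp add: cong_iff_dvd_diff)
  also have "[(\<Sum>(i, j)\<in>S. a i j ^ p * lcoeff G (int p * (u - i), int p * (v - j))) =
      (\<Sum>(i, j)\<in>S. a i j * lcoeff G (int p * (u - i), int p * (v - j)))] (mod int p)"
    by (intro cong_sum) (auto intro!: cong_mult fermat_little_int[OF assms])
  finally show ?thesis by (simp add: S_def)
qed

text \<open>
  The Cartier operator takes out \<open>p\<close>-th powers: multiplying by \<open>P(x^p, y^p)\<close> before applying it
  is the same as multiplying by \<open>P\<close> afterwards.
\<close>

lemma cartier_cong_times_P_poly:
  assumes "prime p" "cartier_cong p G H"
  shows "cartier_cong p (P_poly a ^ p * G) (P_poly a * H)"
  unfolding cartier_cong_def
proof (intro allI)
  fix u v
  have GH: "[lcoeff G (int p * u, int p * v) = lcoeff H (u, v)] (mod int p)" for u v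
    using assms(2) by (simp add: cartier_cong_def)
  show "[lcoeff (P_poly a ^ p * G) (int p * u, int p * v) = lcoeff (P_poly a * H) (u, v)] (mod int p)"
    unfolding lookup_P_poly_times
    by (rule cong_trans[OF lookup_P_poly_prime_power_times[OF assms(1)]],
      rule cong_sum, unfold split_def, rule cong_mult[OF cong_refl GH])
qed

lemma cartier_cong_times_P_poly_power:
  assumes "prime p" "cartier_cong p G H"
  shows "cartier_cong p (P_poly a ^ (p * n) * G) (P_poly a ^ n * H)"
proof (induction n)
  case 0
  then show ?case using assms by simp
next
  case (Suc n)
  show ?case
    using cartier_cong_times_P_poly[OF assms(1) Suc.IH, of a] by (simp add: power_add mult.assoc)
qed

text \<open>
  The exponents of \<open>F\<close> in each variable lie between \<open>-k\<close> and \<open>k + 1\<close>, that is, between \<open>-(p - 1)\<close>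
  and \<open>p\<close>, and \<open>0\<close> and \<open>p\<close> are the only multiples of \<open>p\<close> in this range.
\<close>

lemma cartier_cong_P_poly_power_Q:
  fixes a :: "int \<Rightarrow> int \<Rightarrow> int" and \<alpha> \<beta> \<gamma> \<delta> :: int
  assumes "prime p" "k \<le> p - 1"
  defines "F \<equiv> P_poly a ^ k * Q_eval \<alpha> \<beta> \<gamma> \<delta> lX lY"
  shows "cartier_cong p F (lmonom (ct F) 0 0 + lmonom (lcoeff F (int p, 0)) 1 0
    + lmonom (lcoeff F (0, int p)) 0 1 + lmonom (lcoeff F (int p, int p)) 1 1)"
proof -
  have p2: "p \<ge> 2" using assms(1) prime_ge_2_nat by blast
  have k: "int k < int p" using assms(2) p2 by linarith
  have far: "\<bar>int p * u\<bar> > int k \<and> \<bar>int p * u - 1\<bar> > int k" if "u \<notin> {0, 1}" for u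
  proof -
    consider "u \<le> -1" | "u \<ge> 2" using \<open>u \<notin> {0, 1}\<close> by fastforce
    then show ?thesis
    proof cases
      case 1
      then have "int p * u \<le> int p * (-1)" by (intro mult_left_mono) auto
      then show ?thesis using assms(2) p2 by auto
    next
      case 2
      then have "int p * u \<ge> int p * 2" by (intro mult_left_mono) auto
      then show ?thesis using k p2 by linarith
    qed
  qed
  have "lcoeff F (int p * u, int p * v) = 0" if "u \<notin> {0, 1} \<or> v \<notin> {0, 1}" for u v
    using far[of u] far[of v] that unfolding F_def lookup_Q_eval_times
    by (auto simp: lookup_P_poly_power_eq_0)
  then have "lcoeff F (int p * u, int p * v) = lcoeff (lmonom (ct F) 0 0 + lmonom (lcoeff F (int p, 0)) 1 0
    + lmonom (lcoeff F (0, int p)) 0 1 + lmonom (lcoeff F (int p, int p)) 1 1) (u, v)" for u v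
    by (auto simp: lookup_add lookup_lmonom ct_def)
  then show ?thesis by (simp add: cartier_cong_def)
qed

section \<open>The coefficients at exponents \<open>(p, 0)\<close> and \<open>(p, p)\<close> of \<open>P^(p-1) Q\<close>\<close>

lemma lookup_P_poly_power_corner: "lcoeff (P_poly a ^ m) (int m, int m) = a 1 1 ^ m"
proof (induction m)
  case 0
  then show ?case by (simp add: lookup_one when_def zero_prod_def)
next
  case (Suc m)
  have "lcoeff (P_poly a ^ m) (u, v) = 0" if "u > int m \<or> v > int m" for u v
    using that by (intro lookup_P_poly_power_eq_0) auto
  then show ?case using Suc.IH by (simp add: lookup_P_poly_times add.commute)
qed

text \<open>
  The right hand side distinguishes the same cases as \<open>Q_hat\<close>, whose last coefficient starts with
  \<open>1\<close> or with \<open>a(1,1)\<close> accordingly.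
\<close>

lemma leading_power_cong:
  assumes "prime p"
  shows "[x ^ (p - 1) = (if odd p \<and> \<not> int p dvd x then 1 else x)] (mod int p)"
proof (cases "int p dvd x")
  case True
  then have "int p dvd x ^ (p - 1)"
    using prime_ge_2_nat[OF assms] by (intro dvd_trans[OF True] dvd_power) auto
  with True show ?thesis by (simp add: cong_iff_dvd_diff)
next
  case False
  have "x ^ p = x * x ^ (p - 1)"
    using prime_gt_0_nat[OF assms] by (cases p) auto
  then have "int p dvd x * (x ^ (p - 1) - 1)"
    using fermat_little_int[OF assms, of x] by (simp add: cong_iff_dvd_diff right_diff_distrib)
  then have "int p dvd x ^ (p - 1) - 1"
    using False assms by (simp add: prime_dvd_mult_iff)
  moreover have "p = 2" if "even p"
    using primes_dvd_imp_eq[OF two_is_prime_nat assms that] by simp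
  ultimately show ?thesis using False by (cases "odd p") (auto simp: cong_iff_dvd_diff)
qed

text \<open>
  The monomials \<open>1\<close> and \<open>y\<close> of \<open>Q\<close> do not contribute, since \<open>P^(p-1)\<close> has no term with \<open>x^p\<close>.
  The monomials \<open>x\<close> and \<open>x y\<close> pick the exponents \<open>(p - 1, 0)\<close> and \<open>(p - 1, -1)\<close>, which on the
  right edge are the degrees \<open>p - 1\<close> and \<open>p - 2\<close>.
\<close>

lemma edge_coeff_cong_loc:
  fixes a :: "int \<Rightarrow> int \<Rightarrow> int"
  assumes "prime p"
  shows "cong_loc p
      (of_int (lcoeff (P_poly a ^ (p - 1) * Q_eval \<alpha> \<beta> \<gamma> \<delta> lX lY) (int p, 0)))
      (of_int \<beta> * of_int (sigma_x p a) + of_int \<delta> *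
        (if odd p \<and> \<not> int p dvd a 1 1
         then of_int (a 1 0) / (2 * of_int (a 1 1)) * (1 - of_int (sigma_x p a))
         else of_int (- a 1 (-1) * a 1 0 ^ (p - 2))))"
proof -
  define L where "L = lcoeff (P_poly a ^ (p - 1))"
  define f where "f = [:a 1 (-1), a 1 0, a 1 1:]"
  have p2: "p \<ge> 2" using assms prime_ge_2_nat by blast
  have "L (int p, v) = 0" for v
    unfolding L_def using p2 by (intro lookup_P_poly_power_eq_0) auto
  moreover have "L (int p - 1, 0) = coeff (f ^ (p - 1)) (p - 1)"
    using lookup_P_poly_power_right_edge[of a "p - 1" "p - 1"] p2 by (simp add: L_def f_def of_nat_diff)
  moreover have "L (int p - 1, - 1) = coeff (f ^ (p - 1)) (p - 2)"
    using lookup_P_poly_power_right_edge[of a "p - 1" "p - 2"] p2 by (simp add: L_def f_def of_nat_diff)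
  ultimately have eq: "lcoeff (P_poly a ^ (p - 1) * Q_eval \<alpha> \<beta> \<gamma> \<delta> lX lY) (int p, 0) =
      \<beta> * coeff (f ^ (p - 1)) (p - 1) + \<delta> * coeff (f ^ (p - 1)) (p - 2)"
    unfolding lookup_Q_eval_times L_def[symmetric] by simp
  show ?thesis
    unfolding eq of_int_add of_int_mult[of \<beta>] of_int_mult[of \<delta>] f_def sigma_x_def
    by (intro cong_loc_add cong_loc_mult_left Z_loc_of_int cong_loc_of_int assms
        coeff_prime_minus_two_cong_loc central_trinomial_cong_legendre)
qed

lemma corner_coeff_cong_loc:
  fixes a :: "int \<Rightarrow> int \<Rightarrow> int"
  assumes "prime p"
  shows "cong_loc p
      (of_int (lcoeff (P_poly a ^ (p - 1) * Q_eval \<alpha> \<beta> \<gamma> \<delta> lX lY) (int p, int p)))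
      (of_int \<delta> * (if odd p \<and> \<not> int p dvd a 1 1 then 1 else of_int (a 1 1)))"
proof -
  define L where "L = lcoeff (P_poly a ^ (p - 1))"
  have p2: "p \<ge> 2" using assms prime_ge_2_nat by blast
  have "L (u, v) = 0" if "u > int p - 1 \<or> v > int p - 1" for u v
    unfolding L_def using p2 that by (intro lookup_P_poly_power_eq_0) auto
  moreover have "L (int p - 1, int p - 1) = a 1 1 ^ (p - 1)"
    using lookup_P_poly_power_corner[of a "p - 1"] p2 by (simp add: L_def of_nat_diff)
  ultimately have eq: "lcoeff (P_poly a ^ (p - 1) * Q_eval \<alpha> \<beta> \<gamma> \<delta> lX lY) (int p, int p) =
      \<delta> * a 1 1 ^ (p - 1)"
    unfolding lookup_Q_eval_times L_def[symmetric] by simp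
  have "cong_loc p (of_int (a 1 1 ^ (p - 1))) (of_int (if odd p \<and> \<not> int p dvd a 1 1 then 1 else a 1 1))"
    by (intro cong_loc_of_int leading_power_cong assms)
  then show ?thesis
    unfolding eq of_int_mult if_distrib[of of_int] of_int_1
    by (intro cong_loc_mult_left Z_loc_of_int assms)
qed

lemma lookup_P_poly_power_Q_swap:
  "lcoeff (P_poly a ^ k * Q_eval \<alpha> \<beta> \<gamma> \<delta> lX lY) (u, v) =
   lcoeff (P_poly (\<lambda>i j. a j i) ^ k * Q_eval \<alpha> \<gamma> \<beta> \<delta> lX lY) (v, u)"
  by (simp add: lookup_Q_eval_times lookup_P_poly_power_swap[of a] ac_simps)

text \<open>
  The constant terms cancel. In the coefficient of \<open>x y\<close> the product of the two symbols coming from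
  \<open>Q(\<sigma>_x x, \<sigma>_y y)\<close> cancels against the one in \<open>Q_hat\<close>.
\<close>

lemma Q_tilde_eq_monomials:
  fixes p :: nat and a :: "int \<Rightarrow> int \<Rightarrow> int"
  defines "c \<equiv> odd p \<and> \<not> int p dvd a 1 1"
  shows "Q_tilde p a \<alpha> \<beta> \<gamma> \<delta> =
    lmonom (of_int \<beta> * of_int (sigma_x p a) + of_int \<delta> *
      (if c then of_int (a 1 0) / (2 * of_int (a 1 1)) * (1 - of_int (sigma_x p a))
       else of_int (- a 1 (-1) * a 1 0 ^ (p - 2)))) 1 0
    + lmonom (of_int \<gamma> * of_int (sigma_y p a) + of_int \<delta> *
      (if c then of_int (a 0 1) / (2 * of_int (a 1 1)) * (1 - of_int (sigma_y p a))
       else of_int (- a (-1) 1 * a 0 1 ^ (p - 2)))) 0 1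
    + lmonom (of_int \<delta> * (if c then 1 else of_int (a 1 1))) 1 1"
proof -
  have mult: "lmonom r i j * lmonom s k l = lmonom (r * s) (i + k) (j + l)" for r s :: rat and i j k l
    by (simp add: lmonom_def mult_single)
  have add: "lmonom (r + s) i j = lmonom r i j + lmonom s i j" for r s :: rat and i j
    by (simp add: lmonom_def single_add)
  define qx where "qx = (if c then of_int (a 1 0) / (2 * of_int (a 1 1)) * (1 - of_int (sigma_x p a))
    else rat_of_int (- a 1 (-1) * a 1 0 ^ (p - 2)))"
  define qy where "qy = (if c then of_int (a 0 1) / (2 * of_int (a 1 1)) * (1 - of_int (sigma_y p a))
    else rat_of_int (- a (-1) 1 * a 0 1 ^ (p - 2)))"
  define s where "s = rat_of_int (sigma_x p a) * rat_of_int (sigma_y p a)"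
  define r where "r = (if c then 1 else rat_of_int (a 1 1))"
  have hat: "Q_hat p a = lmonom qx 1 0 + lmonom qy 0 1 + lmonom (r - s) 1 1"
    by (simp add: Q_hat_def Let_def mult qx_def qy_def r_def s_def c_def)
  have corner: "of_int \<delta> * r = of_int \<delta> * s + of_int \<delta> * (r - s)"
    by (simp add: algebra_simps)
  have "Q_tilde p a \<alpha> \<beta> \<gamma> \<delta> = lmonom (of_int \<beta> * of_int (sigma_x p a) + of_int \<delta> * qx) 1 0
    + lmonom (of_int \<gamma> * of_int (sigma_y p a) + of_int \<delta> * qy) 0 1 + lmonom (of_int \<delta> * r) 1 1"
    unfolding corner add Q_tilde_def Q_eval_def hat
    by (simp add: mult distrib_left s_def mult.assoc)
  then show ?thesis by (simp only: qx_def qy_def r_def)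
qed

theorem theorem4p1:
  fixes p :: nat
    and a :: "int \<Rightarrow> int \<Rightarrow> int"
    and \<alpha> \<beta> \<gamma> \<delta> :: int
    and P Q :: "int laurent2"
    and A B :: "nat \<Rightarrow> int"
    and A_tilde :: "nat \<Rightarrow> rat"
    and n k :: nat
  assumes "prime p"
    and "P = P_poly a"
    and "Q = Q_eval \<alpha> \<beta> \<gamma> \<delta> lX lY"
    and "\<And>m. A m = ct (P ^ m * Q)"
    and "\<And>m. B m = ct (P ^ m)"
    and "\<And>m. A_tilde m = ct (rat_laurent P ^ m * Q_tilde p a \<alpha> \<beta> \<gamma> \<delta>)"
    and "k \<in> {0..p - 1}"
  shows "cong_loc p (rat_of_int (A (p * n + k)))
           (rat_of_int (B n * A k) + (if k < p - 1 then 0 else A_tilde n))"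
proof -
  note prime = assms(1)
  define F where "F = P ^ k * Q"
  define N where "N = lcoeff (P ^ n)"
  define X where "X = lcoeff F (int p, 0)"
  define Y where "Y = lcoeff F (0, int p)"
  define Z where "Z = lcoeff F (int p, int p)"
  define H where "H = lmonom (ct F) 0 0 + lmonom X 1 0 + lmonom Y 0 1 + lmonom Z 1 1"
  have "cartier_cong p F H"
    unfolding F_def H_def X_def Y_def Z_def assms(2,3)
    using assms(7) by (intro cartier_cong_P_poly_power_Q[OF prime]) simp
  then have "cartier_cong p (P ^ (p * n) * F) (P ^ n * H)"
    unfolding assms(2) by (rule cartier_cong_times_P_poly_power[OF prime])
  then have "[ct (P ^ (p * n) * F) = ct (P ^ n * H)] (mod int p)"
    unfolding cartier_cong_def ct_def by (auto dest!: spec[of _ 0])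
  moreover have "ct (P ^ (p * n) * F) = A (p * n + k)"
    by (simp add: assms(4) F_def power_add mult.assoc)
  moreover have "ct (P ^ n * H) = B n * A k + (X * N (-1, 0) + Y * N (0, -1) + Z * N (-1, -1))"
    unfolding H_def ct_def N_def
    by (subst mult.commute) (simp add: distrib_right lookup_add lookup_lmonom_times assms(4,5) ct_def F_def)
  ultimately have A_cong: "[A (p * n + k) =
      B n * A k + (X * N (-1, 0) + Y * N (0, -1) + Z * N (-1, -1))] (mod int p)"
    by simp
  show ?thesis
  proof (cases "k < p - 1")
    case True
    have "lcoeff (P ^ k) (u, v) = 0" if "u \<ge> int p - 1 \<or> v \<ge> int p - 1" for u v
      unfolding assms(2) using True that by (intro lookup_P_poly_power_eq_0) auto
    then have "X = 0" "Y = 0" "Z = 0"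
      unfolding X_def Y_def Z_def F_def assms(3) lookup_Q_eval_times by simp_all
    then show ?thesis
      using cong_loc_of_int[OF prime A_cong] True by simp
  next
    case False
    then have k: "k = p - 1" using assms(7) by simp
    define c where "c \<longleftrightarrow> odd p \<and> \<not> int p dvd a 1 1"
    define X' where "X' = of_int \<beta> * of_int (sigma_x p a) + of_int \<delta> *
      (if c then of_int (a 1 0) / (2 * of_int (a 1 1)) * (1 - of_int (sigma_x p a))
       else rat_of_int (- a 1 (-1) * a 1 0 ^ (p - 2)))"
    define Y' where "Y' = of_int \<gamma> * of_int (sigma_y p a) + of_int \<delta> *
      (if c then of_int (a 0 1) / (2 * of_int (a 1 1)) * (1 - of_int (sigma_y p a))
       else rat_of_int (- a (-1) 1 * a 0 1 ^ (p - 2)))"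
    define Z' where "Z' = of_int \<delta> * (if c then 1 else rat_of_int (a 1 1))"
    have "A_tilde n = ct ((lmonom X' 1 0 + lmonom Y' 0 1 + lmonom Z' 1 1) * rat_laurent (P ^ n))"
      unfolding assms(6) Q_tilde_eq_monomials X'_def Y'_def Z'_def c_def assms(2)
        rat_laurent_P_poly_power
      by (subst mult.commute) (rule refl)
    then have tilde: "A_tilde n = of_int (N (-1, 0)) * X' + of_int (N (0, -1)) * Y' + of_int (N (-1, -1)) * Z'"
      by (simp add: ct_def N_def distrib_right lookup_add lookup_lmonom_times lookup_rat_laurent)
    have X: "cong_loc p (of_int X) X'"
      unfolding X_def X'_def F_def c_def k assms(2,3) by (rule edge_coeff_cong_loc[OF prime])
    have "sigma_y p a = sigma_x p (\<lambda>i j. a j i)"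
      by (simp add: sigma_x_def sigma_y_def)
    then have Y: "cong_loc p (of_int Y) Y'"
      unfolding Y_def Y'_def F_def c_def k assms(2,3) lookup_P_poly_power_Q_swap[of a]
      using edge_coeff_cong_loc[OF prime, of "\<lambda>i j. a j i" \<alpha> \<gamma> \<beta> \<delta>] by (simp only:)
    have Z: "cong_loc p (of_int Z) Z'"
      unfolding Z_def Z'_def F_def c_def k assms(2,3) by (rule corner_coeff_cong_loc[OF prime])
    have "cong_loc p (of_int (B n * A k) + (of_int (N (-1, 0)) * of_int X
        + of_int (N (0, -1)) * of_int Y + of_int (N (-1, -1)) * of_int Z)) (of_int (B n * A k) + A_tilde n)"
      unfolding tilde
      by (intro cong_loc_add[OF prime] cong_loc_mult_left[OF prime] Z_loc_of_int[OF prime]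
          cong_loc_of_int[OF prime] cong_refl X Y Z)
    then have "cong_loc p (of_int (B n * A k + (X * N (-1, 0) + Y * N (0, -1) + Z * N (-1, -1))))
        (of_int (B n * A k) + A_tilde n)"
      by (simp add: mult.commute)
    then show ?thesis
      using cong_loc_trans_int[OF prime A_cong] False by simp
  qed
qed

end
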